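(* For every connected graph $F$ other than $P_2$ and $P_3$, we have $D_v(F)\ge (v(F)+1)/2$ and $W_v(F)\ge (v(F)-1)/2$.
   Context: Graphs are finite simple graphs; $v(F)$ is the number of vertices; $P_n$ is the path on $n$ vertices. We use first-order logic of graphs with relation symbols for adjacency and equality only; variable width of a sentence is the number of distinct variables it uses. $D_v(F)$ (resp. $W_v(F)$) is the minimum quantifier depth (resp. variable width) of a first-order sentence $\Phi$ for which there is an integer $k$ such that for every connected graph $G$ with at least $k$ vertices, $G\models\Phi$ if and only if $G$ contains a (not necessarily induced) subgraph isomorphic to $F$. *)

theory Defs
  imports Complex_Main
begin

definition is_graph :: "'a set \<Rightarrow> ('a \<Rightarrow> 'a \<Rightarrow> bool) \<Rightarrow> bool" where
  "is_graph V E \<longleftrightarrow> finite V \<and> (\<forall>u v. E u v \<longrightarrow> u \<in> V \<and> v \<in> V)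
     \<and> (\<forall>u v. E u v \<longrightarrow> E v u) \<and> (\<forall>u. \<not> E u u)"

definition connected_graph :: "'a set \<Rightarrow> ('a \<Rightarrow> 'a \<Rightarrow> bool) \<Rightarrow> bool" where
  "connected_graph V E \<longleftrightarrow> is_graph V E \<and> V \<noteq> {} \<and> (\<forall>u\<in>V. \<forall>v\<in>V. E\<^sup>*\<^sup>* u v)"

definition contains_subgraph ::
  "'b set \<Rightarrow> ('b \<Rightarrow> 'b \<Rightarrow> bool) \<Rightarrow> 'a set \<Rightarrow> ('a \<Rightarrow> 'a \<Rightarrow> bool) \<Rightarrow> bool" where
  "contains_subgraph VG EG VF EF \<longleftrightarrow>
     (\<exists>f. inj_on f VF \<and> f ` VF \<subseteq> VG \<and> (\<forall>u\<in>VF. \<forall>v\<in>VF. EF u v \<longrightarrow> EG (f u) (f v)))"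

definition graph_iso ::
  "'a set \<Rightarrow> ('a \<Rightarrow> 'a \<Rightarrow> bool) \<Rightarrow> 'b set \<Rightarrow> ('b \<Rightarrow> 'b \<Rightarrow> bool) \<Rightarrow> bool" where
  "graph_iso V1 E1 V2 E2 \<longleftrightarrow>
     (\<exists>f. bij_betw f V1 V2 \<and> (\<forall>u\<in>V1. \<forall>v\<in>V1. E1 u v \<longleftrightarrow> E2 (f u) (f v)))"

definition path_V :: "nat \<Rightarrow> nat set" where
  "path_V n = {0..<n}"

definition path_E :: "nat \<Rightarrow> nat \<Rightarrow> nat \<Rightarrow> bool" where
  "path_E n i j \<longleftrightarrow> i < n \<and> j < n \<and> (j = i + 1 \<or> i = j + 1)"

datatype fo =
    Adj nat nat
  | Eq nat nat
  | Neg fo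
  | Conj fo fo
  | Disj fo fo
  | Ex nat fo
  | All nat fo

fun sat :: "'b set \<Rightarrow> ('b \<Rightarrow> 'b \<Rightarrow> bool) \<Rightarrow> (nat \<Rightarrow> 'b) \<Rightarrow> fo \<Rightarrow> bool" where
  "sat V E \<sigma> (Adj x y) = E (\<sigma> x) (\<sigma> y)"
| "sat V E \<sigma> (Eq x y) = (\<sigma> x = \<sigma> y)"
| "sat V E \<sigma> (Neg \<phi>) = (\<not> sat V E \<sigma> \<phi>)"
| "sat V E \<sigma> (Conj \<phi> \<psi>) = (sat V E \<sigma> \<phi> \<and> sat V E \<sigma> \<psi>)"
| "sat V E \<sigma> (Disj \<phi> \<psi>) = (sat V E \<sigma> \<phi> \<or> sat V E \<sigma> \<psi>)"
| "sat V E \<sigma> (Ex x \<phi>) = (\<exists>v\<in>V. sat V E (\<sigma>(x := v)) \<phi>)"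
| "sat V E \<sigma> (All x \<phi>) = (\<forall>v\<in>V. sat V E (\<sigma>(x := v)) \<phi>)"

fun fv :: "fo \<Rightarrow> nat set" where
  "fv (Adj x y) = {x, y}"
| "fv (Eq x y) = {x, y}"
| "fv (Neg \<phi>) = fv \<phi>"
| "fv (Conj \<phi> \<psi>) = fv \<phi> \<union> fv \<psi>"
| "fv (Disj \<phi> \<psi>) = fv \<phi> \<union> fv \<psi>"
| "fv (Ex x \<phi>) = fv \<phi> - {x}"
| "fv (All x \<phi>) = fv \<phi> - {x}"

fun vars :: "fo \<Rightarrow> nat set" where
  "vars (Adj x y) = {x, y}"
| "vars (Eq x y) = {x, y}"
| "vars (Neg \<phi>) = vars \<phi>"
| "vars (Conj \<phi> \<psi>) = vars \<phi> \<union> vars \<psi>"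
| "vars (Disj \<phi> \<psi>) = vars \<phi> \<union> vars \<psi>"
| "vars (Ex x \<phi>) = insert x (vars \<phi>)"
| "vars (All x \<phi>) = insert x (vars \<phi>)"

fun qdepth :: "fo \<Rightarrow> nat" where
  "qdepth (Adj x y) = 0"
| "qdepth (Eq x y) = 0"
| "qdepth (Neg \<phi>) = qdepth \<phi>"
| "qdepth (Conj \<phi> \<psi>) = max (qdepth \<phi>) (qdepth \<psi>)"
| "qdepth (Disj \<phi> \<psi>) = max (qdepth \<phi>) (qdepth \<psi>)"
| "qdepth (Ex x \<phi>) = Suc (qdepth \<phi>)"
| "qdepth (All x \<phi>) = Suc (qdepth \<phi>)"

definition width :: "fo \<Rightarrow> nat" where
  "width \<phi> = card (vars \<phi>)"

definition sentence :: "fo \<Rightarrow> bool" where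
  "sentence \<phi> \<longleftrightarrow> fv \<phi> = {}"

text \<open>Phi defines F-subgraph containment on all sufficiently large connected graphs.
 Host graphs range over graphs with vertices in nat; every finite graph is isomorphic
 to such a graph and both truth and subgraph containment are isomorphism-invariant.
 For a sentence the assignment is irrelevant; we use an arbitrary fixed one.\<close>
definition defines_F_ev :: "'a set \<Rightarrow> ('a \<Rightarrow> 'a \<Rightarrow> bool) \<Rightarrow> fo \<Rightarrow> bool" where
  "defines_F_ev VF EF \<Phi> \<longleftrightarrow> sentence \<Phi> \<and>
     (\<exists>k::nat. \<forall>(V::nat set) E. connected_graph V E \<and> card V \<ge> k \<longrightarrow>
        (sat V E (\<lambda>_. undefined) \<Phi> \<longleftrightarrow> contains_subgraph V E VF EF))"

definition D_v :: "'a set \<Rightarrow> ('a \<Rightarrow> 'a \<Rightarrow> bool) \<Rightarrow> nat" where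
  "D_v VF EF = (LEAST d. \<exists>\<Phi>. defines_F_ev VF EF \<Phi> \<and> qdepth \<Phi> = d)"

definition W_v :: "'a set \<Rightarrow> ('a \<Rightarrow> 'a \<Rightarrow> bool) \<Rightarrow> nat" where
  "W_v VF EF = (LEAST w. \<exists>\<Phi>. defines_F_ev VF EF \<Phi> \<and> width \<Phi> = w)"

end

theory Submission
  imports Defs
begin

text \<open>
  Let \<open>v = card VF\<close> and \<open>s = v div 2\<close>. Glue a clique with \<open>m\<close> vertices to a large connected
  graph (a long path, or a star with many leaves) along one vertex \<open>r\<close>, the end of the path or the
  centre of the star. For cliques of size \<open>s\<close> and \<open>v\<close> the resulting graphs cannot be told
  apart by \<open>s\<close> rounds of the Ehrenfeucht game, nor by \<open>s - 1\<close> pebbles, because all clique vertices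
  other than \<open>r\<close> are interchangeable. The graph with the clique of size \<open>v\<close> contains \<open>F\<close>.
  If \<open>F\<close> also embedded into both graphs with the clique of size \<open>s\<close>, then at least \<open>v - s\<close> vertices
  of \<open>F\<close> would lie on a pendant path, and at least \<open>v - s\<close> would be leaves with a common neighbour
  \<open>c\<close>. These two sets and \<open>{c}\<close> are disjoint unless \<open>F = P\<^sub>3\<close>, so \<open>2 (v - s) + 1 \<le> v\<close>,
  a contradiction.
\<close>

section \<open>Back-and-forth systems\<close>

definition partial_iso ::
  "('b \<Rightarrow> 'b \<Rightarrow> bool) \<Rightarrow> ('c \<Rightarrow> 'c \<Rightarrow> bool) \<Rightarrow> nat set \<Rightarrow> (nat \<Rightarrow> 'b) \<Rightarrow> (nat \<Rightarrow> 'c) \<Rightarrow> bool" where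
  "partial_iso E E' D \<sigma> \<tau> \<longleftrightarrow>
     (\<forall>x\<in>D. \<forall>y\<in>D. (\<sigma> x = \<sigma> y \<longleftrightarrow> \<tau> x = \<tau> y) \<and> (E (\<sigma> x) (\<sigma> y) \<longleftrightarrow> E' (\<tau> x) (\<tau> y)))"

text \<open>\<open>R n D \<sigma> \<tau>\<close>: Duplicator survives \<open>n\<close> further rounds when exactly the variables in \<open>D\<close>
  have been assigned.\<close>

lemma back_and_forth_sat_iff:
  assumes zig: "\<And>n D \<sigma> \<tau> x u. R (Suc n) D \<sigma> \<tau> \<Longrightarrow> x \<in> X \<Longrightarrow> u \<in> V \<Longrightarrow>
      \<exists>u'\<in>V'. R n (insert x D) (\<sigma>(x := u)) (\<tau>(x := u'))"
    and zag: "\<And>n D \<sigma> \<tau> x u'. R (Suc n) D \<sigma> \<tau> \<Longrightarrow> x \<in> X \<Longrightarrow> u' \<in> V' \<Longrightarrow>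
      \<exists>u\<in>V. R n (insert x D) (\<sigma>(x := u)) (\<tau>(x := u'))"
    and mono: "\<And>m n D \<sigma> \<tau>. R n D \<sigma> \<tau> \<Longrightarrow> m \<le> n \<Longrightarrow> R m D \<sigma> \<tau>"
    and iso: "\<And>n D \<sigma> \<tau>. R n D \<sigma> \<tau> \<Longrightarrow> partial_iso E E' D \<sigma> \<tau>"
    and "vars \<phi> \<subseteq> X" "fv \<phi> \<subseteq> D" "R (qdepth \<phi>) D \<sigma> \<tau>"
  shows "sat V E \<sigma> \<phi> \<longleftrightarrow> sat V' E' \<tau> \<phi>"
  using assms(5-7)
proof (induction \<phi> arbitrary: D \<sigma> \<tau>)
  case (Adj x y)
  then show ?case using iso[OF Adj(3)] by (auto simp: partial_iso_def)
next
  case (Eq x y)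
  then show ?case using iso[OF Eq(3)] by (auto simp: partial_iso_def)
next
  case (Neg \<phi>)
  then show ?case by simp
next
  case (Conj \<phi> \<psi>)
  have "R (qdepth \<phi>) D \<sigma> \<tau>" "R (qdepth \<psi>) D \<sigma> \<tau>"
    using mono[OF Conj.prems(3)] by auto
  then show ?case using Conj by auto
next
  case (Disj \<phi> \<psi>)
  have "R (qdepth \<phi>) D \<sigma> \<tau>" "R (qdepth \<psi>) D \<sigma> \<tau>"
    using mono[OF Disj.prems(3)] by auto
  then show ?case using Disj by auto
next
  case (Ex x \<phi>)
  \<comment> \<open>Moves only reassign variables in \<open>X\<close>; this lets a bound on the
    number of variables act as a bound on the number of pebbles.\<close>
  have R: "R (Suc (qdepth \<phi>)) D \<sigma> \<tau>" and x: "x \<in> X" and \<phi>: "vars \<phi> \<subseteq> X" "fv \<phi> \<subseteq> insert x D"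
    using Ex.prems by auto
  show ?case using zig[OF R x] zag[OF R x] Ex.IH[OF \<phi>] by simp meson
next
  case (All x \<phi>)
  have R: "R (Suc (qdepth \<phi>)) D \<sigma> \<tau>" and x: "x \<in> X" and \<phi>: "vars \<phi> \<subseteq> X" "fv \<phi> \<subseteq> insert x D"
    using All.prems by auto
  show ?case using zig[OF R x] zag[OF R x] All.IH[OF \<phi>] by simp meson
qed

section \<open>Gluing a clique to a graph\<close>

text \<open>\<open>A\<close> consists of the new vertices only. The clique is
  \<open>insert r A\<close>, which has one vertex more than \<open>A\<close> when \<open>r\<close>
  lies outside it; hence the shifts by one in the size conditions below.\<close>

definition clique_glued ::
  "('b \<Rightarrow> 'b \<Rightarrow> bool) \<Rightarrow> 'b \<Rightarrow> 'b set \<Rightarrow> 'b \<Rightarrow> 'b \<Rightarrow> bool" where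
  "clique_glued E r A u v \<longleftrightarrow> E u v \<or> u \<noteq> v \<and> u \<in> insert r A \<and> v \<in> insert r A"

lemma connected_clique_glued:
  assumes "connected_graph T E" "r \<in> T" "finite A"
  shows "connected_graph (T \<union> A) (clique_glued E r A)"
proof -
  let ?G = "clique_glued E r A"
  have g: "is_graph (T \<union> A) ?G"
    using assms unfolding connected_graph_def is_graph_def clique_glued_def by auto
  have E: "E\<^sup>*\<^sup>* u v" if "u \<in> T" "v \<in> T" for u v
    using assms that by (auto simp: connected_graph_def)
  have mono: "?G\<^sup>*\<^sup>* u v" if "E\<^sup>*\<^sup>* u v" for u v
    using that by (rule rtranclp_mono[THEN predicate2D, rotated]) (auto simp: clique_glued_def)
  have to: "?G\<^sup>*\<^sup>* u r \<and> ?G\<^sup>*\<^sup>* r u" if "u \<in> T \<union> A" for u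
  proof (cases "u \<in> T")
    case True
    then show ?thesis using E mono assms(2) by blast
  next
    case False
    then have "?G u r" "?G r u" using that assms(2) by (auto simp: clique_glued_def)
    then show ?thesis by blast
  qed
  have "?G\<^sup>*\<^sup>* u v" if "u \<in> T \<union> A" "v \<in> T \<union> A" for u v
    using to[OF that(1)] to[OF that(2)] by (meson rtranclp_trans)
  then show ?thesis using g assms(2) by (auto simp: connected_graph_def)
qed

lemma contains_subgraph_clique:
  assumes "is_graph VF EF" "finite K" "card VF \<le> card K" "K \<subseteq> V"
    and "\<And>u v. u \<in> K \<Longrightarrow> v \<in> K \<Longrightarrow> u \<noteq> v \<Longrightarrow> E u v"
  shows "contains_subgraph V E VF EF"
proof -
  have "finite VF" using assms(1) by (simp add: is_graph_def)
  then obtain f where f: "f ` VF \<subseteq> K" "inj_on f VF"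
    using card_le_inj assms(2,3) by metis
  have "E (f u) (f v)" if "u \<in> VF" "v \<in> VF" "EF u v" for u v
  proof -
    have "u \<noteq> v" using that assms(1) by (auto simp: is_graph_def)
    then have "f u \<noteq> f v" using f that by (auto dest: inj_onD)
    then show ?thesis using assms(5) f that by blast
  qed
  then show ?thesis using f assms(4) unfolding contains_subgraph_def by blast
qed

section \<open>The game on two gluings along the same vertex\<close>

definition matched ::
  "'b set \<Rightarrow> 'b set \<Rightarrow> 'b set \<Rightarrow> nat set \<Rightarrow> (nat \<Rightarrow> 'b) \<Rightarrow> (nat \<Rightarrow> 'b) \<Rightarrow> bool" where
  "matched T A A' D \<sigma> \<tau> \<longleftrightarrow>
     (\<forall>x\<in>D. \<sigma> x \<in> T \<and> \<tau> x = \<sigma> x \<or> \<sigma> x \<in> A \<and> \<tau> x \<in> A') \<and>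
     (\<forall>x\<in>D. \<forall>y\<in>D. \<sigma> x = \<sigma> y \<longleftrightarrow> \<tau> x = \<tau> y)"

lemma matched_sym:
  "matched T A A' D \<sigma> \<tau> \<Longrightarrow> matched T A' A D \<tau> \<sigma>"
  unfolding matched_def by auto

lemma partial_iso_sym:
  "partial_iso E E' D \<sigma> \<tau> \<Longrightarrow> partial_iso E' E D \<tau> \<sigma>"
  unfolding partial_iso_def by auto

text \<open>All vertices of \<open>A\<close> look alike: each is adjacent exactly to the other
  members of \<open>insert r A\<close>. As \<open>r\<close> lies in \<open>T\<close> and is matched
  only with itself, the equality pattern already determines every adjacency.\<close>

lemma matched_partial_iso:
  assumes "matched T A A' D \<sigma> \<tau>" "is_graph T E" "r \<in> T" "T \<inter> A = {}" "T \<inter> A' = {}"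
  shows "partial_iso (clique_glued E r A) (clique_glued E r A') D \<sigma> \<tau>"
  unfolding partial_iso_def
proof (intro ballI conjI)
  fix x y assume xy: "x \<in> D" "y \<in> D"
  show eq: "\<sigma> x = \<sigma> y \<longleftrightarrow> \<tau> x = \<tau> y" using xy assms(1) by (auto simp: matched_def)
  have ET: "u \<in> T \<and> v \<in> T" if "E u v" for u v using that assms(2) by (auto simp: is_graph_def)
  have "\<sigma> x \<in> T \<and> \<tau> x = \<sigma> x \<or> \<sigma> x \<in> A \<and> \<tau> x \<in> A'" "\<sigma> y \<in> T \<and> \<tau> y = \<sigma> y \<or> \<sigma> y \<in> A \<and> \<tau> y \<in> A'"
    using xy assms(1) by (auto simp: matched_def)
  then show "clique_glued E r A (\<sigma> x) (\<sigma> y) \<longleftrightarrow> clique_glued E r A' (\<tau> x) (\<tau> y)"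
    using eq assms(3-5) ET[of "\<sigma> x" "\<sigma> y"] ET[of "\<tau> x" "\<tau> y"] unfolding clique_glued_def
    by (elim disjE conjE) auto
qed

lemma matched_extend:
  assumes m: "matched T A A' D \<sigma> \<tau>" and "T \<inter> A = {}" "T \<inter> A' = {}" and u: "u \<in> T \<union> A"
    and room: "u \<in> T \<or> u \<in> \<sigma> ` (D - {x}) \<or> \<not> A' \<subseteq> \<tau> ` (D - {x})"
  shows "\<exists>u'\<in>T \<union> A'. matched T A A' (insert x D) (\<sigma>(x := u)) (\<tau>(x := u'))"
proof -
  have ok: ?thesis if "u \<in> T \<and> u' = u \<or> u \<in> A \<and> u' \<in> A'"
    and "\<And>y. y \<in> D - {x} \<Longrightarrow> \<sigma> y = u \<longleftrightarrow> \<tau> y = u'" for u'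
  proof (rule bexI[of _ u'])
    show "matched T A A' (insert x D) (\<sigma>(x := u)) (\<tau>(x := u'))"
      using m that unfolding matched_def
      by (smt (verit, ccfv_threshold) Diff_iff fun_upd_apply insert_iff singletonD)
  qed (use that in auto)
  consider "u \<in> T" | "u \<in> A" "u \<in> \<sigma> ` (D - {x})"
    | "u \<in> A" "u \<notin> \<sigma> ` (D - {x})" "\<not> A' \<subseteq> \<tau> ` (D - {x})"
    using u room by blast
  then show ?thesis
  proof cases
    case 1
    show ?thesis by (rule ok[of u]) (use 1 m assms(2,3) in \<open>auto simp: matched_def\<close>)
  next
    case 2
    then obtain z where z: "z \<in> D - {x}" "u = \<sigma> z" by blast
    show ?thesis by (rule ok[of "\<tau> z"]) (use z m in \<open>auto simp: matched_def\<close>)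
  next
    case 3
    then obtain u' where "u' \<in> A'" "u' \<notin> \<tau> ` (D - {x})" by blast
    then show ?thesis by (intro ok[of u']) (use 3 in auto)
  qed
qed

text \<open>In the last round Duplicator may answer with \<open>r\<close> if all other clique vertices are taken,
  since then no vertex outside \<open>A\<close> has been chosen.\<close>

lemma partial_iso_last_round:
  assumes m: "matched T A A' D \<sigma> \<tau>" and "is_graph T E" and r: "r \<in> T"
    and T: "T \<inter> A = {}" "T \<inter> A' = {}" and u: "u \<in> T \<union> A"
    and D: "finite D" "card D \<le> card A'"
  shows "\<exists>u'\<in>T \<union> A'. partial_iso (clique_glued E r A) (clique_glued E r A')
    (insert x D) (\<sigma>(x := u)) (\<tau>(x := u'))"
proof (cases "u \<in> T \<or> u \<in> \<sigma> ` (D - {x}) \<or> \<not> A' \<subseteq> \<tau> ` (D - {x})")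
  case True
  then show ?thesis
    using matched_extend[OF m T u True] matched_partial_iso[OF _ assms(2,3) T] by blast
next
  case False
  then have uA: "u \<in> A" and new: "u \<notin> \<sigma> ` (D - {x})" and sub: "A' \<subseteq> \<tau> ` (D - {x})"
    using u by auto
  \<comment> \<open>Together with \<open>card D \<le> card A'\<close> this forces
    \<open>x \<notin> D\<close> and makes the image of \<open>D\<close> under \<open>\<tau>\<close>
    exactly \<open>A'\<close>.\<close>
  have "card A' \<le> card (D - {x})"
    using sub D(1) by (meson card_image_le card_mono finite_Diff finite_imageI le_trans)
  then have xD: "x \<notin> D" using D by (metis card_Diff1_less not_le order_trans)
  then have sub: "A' \<subseteq> \<tau> ` D" and new: "u \<notin> \<sigma> ` D" using sub new by auto
  have "\<tau> ` D = A'"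
    using sub D by (metis card_image_le card_seteq finite_imageI order_trans)
  then have A': "\<tau> y \<in> A'" if "y \<in> D" for y using that by auto
  then have A: "\<sigma> y \<in> A" if "y \<in> D" for y
    using that m T(2) A'[OF that] by (fastforce simp: matched_def)
  have inj: "\<sigma> y = \<sigma> z \<longleftrightarrow> \<tau> y = \<tau> z" if "y \<in> D" "z \<in> D" for y z
    using that m by (auto simp: matched_def)
  define \<sigma>' where "\<sigma>' = \<sigma>(x := u)"
  \<comment> \<open>The answer \<open>r\<close> is adjacent to every vertex of \<open>A'\<close>,
    just as \<open>u\<close> is to the earlier choices in \<open>A\<close>. The new position is no
    longer matched, because \<open>u\<close> lies in \<open>A\<close> and \<open>r\<close> in
    \<open>T\<close>, so the strategy cannot continue from it.\<close>
  define \<tau>' where "\<tau>' = \<tau>(x := r)"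
  have "\<sigma>' y \<in> A \<and> \<tau>' y \<in> insert r A'" if "y \<in> insert x D" for y
    using that A A' uA by (auto simp: \<sigma>'_def \<tau>'_def)
  moreover have "\<sigma>' y = \<sigma>' z \<longleftrightarrow> \<tau>' y = \<tau>' z" if "y \<in> insert x D" "z \<in> insert x D" for y z
    using that inj new xD r A' T(2) unfolding \<sigma>'_def \<tau>'_def by fastforce
  moreover have ET: "v \<in> T \<and> w \<in> T" if "E v w" for v w
    using that assms(2) by (auto simp: is_graph_def)
  moreover have "\<not> E v v" for v using assms(2) by (auto simp: is_graph_def)
  ultimately have "partial_iso (clique_glued E r A) (clique_glued E r A') (insert x D) \<sigma>' \<tau>'"
    using T unfolding partial_iso_def clique_glued_def by (smt (verit, best) disjoint_iff insert_iff)
  then show ?thesis using r unfolding \<sigma>'_def \<tau>'_def by blast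
qed

text \<open>The second disjunct records a position after the last round.\<close>

definition duplicator_wins ::
  "nat \<Rightarrow> nat set \<Rightarrow> ('b \<Rightarrow> 'b \<Rightarrow> bool) \<Rightarrow> 'b \<Rightarrow> 'b set \<Rightarrow> 'b set \<Rightarrow> 'b set \<Rightarrow>
    nat \<Rightarrow> nat set \<Rightarrow> (nat \<Rightarrow> 'b) \<Rightarrow> (nat \<Rightarrow> 'b) \<Rightarrow> bool" where
  "duplicator_wins s X E r T A A' n D \<sigma> \<tau> \<longleftrightarrow> D \<subseteq> X \<and>
     (matched T A A' D \<sigma> \<tau> \<and> (card X < s \<or> card D + n \<le> s) \<or>
      n = 0 \<and> partial_iso (clique_glued E r A) (clique_glued E r A') D \<sigma> \<tau>)"

lemma duplicator_wins_sym:
  "duplicator_wins s X E r T A A' n D \<sigma> \<tau> \<Longrightarrow> duplicator_wins s X E r T A' A n D \<tau> \<sigma>"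
  unfolding duplicator_wins_def using matched_sym partial_iso_sym by metis

lemma duplicator_wins_forth:
  assumes R: "duplicator_wins s X E r T A A' (Suc n) D \<sigma> \<tau>" and "is_graph T E" "r \<in> T"
    and T: "T \<inter> A = {}" "T \<inter> A' = {}" and A': "finite A'" "s \<le> Suc (card A')"
    and X: "finite X" "x \<in> X" and u: "u \<in> T \<union> A"
  shows "\<exists>u'\<in>T \<union> A'. duplicator_wins s X E r T A A' n (insert x D) (\<sigma>(x := u)) (\<tau>(x := u'))"
proof -
  have m: "matched T A A' D \<sigma> \<tau>" and c: "card X < s \<or> card D + Suc n \<le> s" and D: "D \<subseteq> X"
    using R by (auto simp: duplicator_wins_def)
  have fin: "finite D" using D X by (auto intro: finite_subset)
  have c': "card X < s \<or> card (insert x D) + n \<le> s"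
    using c card_insert_le_m1[of "Suc (card D)" D x] by auto
  show ?thesis
  proof (cases "card (D - {x}) < card A'")
    case True
    then have "\<not> A' \<subseteq> \<tau> ` (D - {x})"
      using fin by (meson card_image_le card_mono finite_Diff finite_imageI le_trans not_le)
    then show ?thesis
      using matched_extend[OF m T u, of x] c' D X(2) unfolding duplicator_wins_def by blast
  next
    case False
    have "card (D - {x}) < card X"
      using D X by (intro psubset_card_mono) auto
    then have "\<not> card X < s" using False A' by auto
    moreover have "card (D - {x}) \<le> card D" using fin by (simp add: card_mono)
    ultimately have "n = 0" "card D \<le> card A'" using False A' c by auto
    then show ?thesis
      using partial_iso_last_round[OF m assms(2,3) T u fin, of x] D X(2)
      unfolding duplicator_wins_def by auto
  qed
qed

lemma vars_finite: "finite (vars \<phi>)"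
  by (induction \<phi>) auto

text \<open>Both cliques have at least \<open>s\<close> vertices. The game starts with no pebbles,
  where \<open>matched\<close> holds vacuously for any two assignments, and one relation serves the
  depth bound and the width bound at once.\<close>

lemma clique_glued_sat_iff:
  assumes "sentence \<phi>" and T: "is_graph T E" "r \<in> T"
    and A: "finite A" "T \<inter> A = {}" "s \<le> Suc (card A)"
    and A': "finite A'" "T \<inter> A' = {}" "s \<le> Suc (card A')"
    and s: "card (vars \<phi>) < s \<or> qdepth \<phi> \<le> s"
  shows "sat (T \<union> A) (clique_glued E r A) \<sigma> \<phi> \<longleftrightarrow> sat (T \<union> A') (clique_glued E r A') \<tau> \<phi>"
proof (rule back_and_forth_sat_iff[where R = "duplicator_wins s (vars \<phi>) E r T A A'" and X = "vars \<phi>"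
      and D = "{}"])
  let ?R = "duplicator_wins s (vars \<phi>) E r T A A'"
  show "\<exists>u'\<in>T \<union> A'. ?R n (insert x D) (\<sigma>(x := u)) (\<tau>(x := u'))"
    if "?R (Suc n) D \<sigma> \<tau>" "x \<in> vars \<phi>" "u \<in> T \<union> A" for n D \<sigma> \<tau> x u
    using duplicator_wins_forth[OF that(1) T A(2) A'(2) A'(1) A'(3) vars_finite that(2,3)] .
  show "\<exists>u\<in>T \<union> A. ?R n (insert x D) (\<sigma>(x := u)) (\<tau>(x := u'))"
    if prems: "?R (Suc n) D \<sigma> \<tau>" "x \<in> vars \<phi>" "u' \<in> T \<union> A'" for n D \<sigma> \<tau> x u'
  proof -
    obtain u where u: "u \<in> T \<union> A"
      "duplicator_wins s (vars \<phi>) E r T A' A n (insert x D) (\<tau>(x := u')) (\<sigma>(x := u))"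
      using duplicator_wins_forth[OF duplicator_wins_sym[OF prems(1)] T A'(2) A(2) A(1) A(3)
          vars_finite prems(2,3)] by blast
    show ?thesis using duplicator_wins_sym[OF u(2)] u(1) by blast
  qed
  show "?R m D \<sigma> \<tau>" if "?R n D \<sigma> \<tau>" "m \<le> n" for m n D \<sigma> \<tau>
    using that by (auto simp: duplicator_wins_def)
  show "partial_iso (clique_glued E r A) (clique_glued E r A') D \<sigma> \<tau>" if "?R n D \<sigma> \<tau>" for n D \<sigma> \<tau>
    using that matched_partial_iso[OF _ T A(2) A'(2)] by (auto simp: duplicator_wins_def)
  show "?R (qdepth \<phi>) {} \<sigma> \<tau>"
    using s by (auto simp: duplicator_wins_def matched_def)
qed (use assms(1) in \<open>auto simp: sentence_def\<close>)

section \<open>Definability of subgraph containment\<close>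

text \<open>The syntax has no constant for truth. The quantifier in the empty case keeps it closed,
  so the terminator adds no free variable.\<close>

fun conj_list :: "fo list \<Rightarrow> fo" where
  "conj_list [] = All 0 (Eq 0 0)"
| "conj_list (\<phi> # \<phi>s) = Conj \<phi> (conj_list \<phi>s)"

lemma sat_conj_list: "sat V E \<sigma> (conj_list \<phi>s) \<longleftrightarrow> (\<forall>\<phi>\<in>set \<phi>s. sat V E \<sigma> \<phi>)"
  by (induction \<phi>s) auto

lemma fv_conj_list: "fv (conj_list \<phi>s) = (\<Union>\<phi>\<in>set \<phi>s. fv \<phi>)"
  by (induction \<phi>s) auto

lemma fv_foldr_Ex: "fv (foldr Ex xs \<phi>) = fv \<phi> - set xs"
  by (induction xs) auto

lemma sat_foldr_Ex:
  "sat V E \<sigma> (foldr Ex xs \<phi>) \<longleftrightarrow>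
     (\<exists>\<tau>. (\<forall>x\<in>set xs. \<tau> x \<in> V) \<and> (\<forall>x. x \<notin> set xs \<longrightarrow> \<tau> x = \<sigma> x) \<and> sat V E \<tau> \<phi>)"
proof (induction xs arbitrary: \<sigma>)
  case Nil
  have "(\<forall>x. \<tau> x = \<sigma> x) \<longleftrightarrow> \<tau> = \<sigma>" for \<tau> by auto
  then show ?case by simp
next
  case (Cons y xs)
  show ?case
  proof
    assume "sat V E \<sigma> (foldr Ex (y # xs) \<phi>)"
    then obtain u \<tau> where "u \<in> V" "\<forall>x\<in>set xs. \<tau> x \<in> V"
      "\<forall>x. x \<notin> set xs \<longrightarrow> \<tau> x = (\<sigma>(y := u)) x" "sat V E \<tau> \<phi>"
      using Cons.IH by auto
    then show "\<exists>\<tau>. (\<forall>x\<in>set (y # xs). \<tau> x \<in> V) \<and> (\<forall>x. x \<notin> set (y # xs) \<longrightarrow> \<tau> x = \<sigma> x) \<and> sat V E \<tau> \<phi>"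
      by (intro exI[of _ \<tau>]) (metis fun_upd_apply set_ConsD list.set_intros)
  next
    assume "\<exists>\<tau>. (\<forall>x\<in>set (y # xs). \<tau> x \<in> V) \<and> (\<forall>x. x \<notin> set (y # xs) \<longrightarrow> \<tau> x = \<sigma> x) \<and> sat V E \<tau> \<phi>"
    then obtain \<tau> where \<tau>: "\<forall>x\<in>set (y # xs). \<tau> x \<in> V" "\<forall>x. x \<notin> set (y # xs) \<longrightarrow> \<tau> x = \<sigma> x"
      "sat V E \<tau> \<phi>" by blast
    then have "sat V E (\<sigma>(y := \<tau> y)) (foldr Ex xs \<phi>)"
      unfolding Cons.IH by (intro exI[of _ \<tau>]) auto
    then show "sat V E \<sigma> (foldr Ex (y # xs) \<phi>)" using \<tau>(1) by auto
  qed
qed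

text \<open>Without this, \<open>D_v\<close> and \<open>W_v\<close> would be \<open>LEAST\<close> over an empty predicate.\<close>

lemma ex_defining_sentence:
  assumes "finite VF"
  shows "\<exists>\<Phi>. defines_F_ev VF EF \<Phi>"
proof -
  define n where "n = card VF"
  obtain h where h: "bij_betw h {0..<n} VF"
    using ex_bij_betw_nat_finite[OF assms] n_def by blast
  \<comment> \<open>Variable \<open>i\<close> stands for the vertex \<open>h i\<close>: the
    variables are pairwise distinct and realise every edge of F.\<close>
  define \<phi>s where "\<phi>s = [Neg (Eq i j). i \<leftarrow> [0..<n], j \<leftarrow> [0..<n], i \<noteq> j]
    @ [Adj i j. i \<leftarrow> [0..<n], j \<leftarrow> [0..<n], EF (h i) (h j)]"
  define \<Phi> where "\<Phi> = foldr Ex [0..<n] (conj_list \<phi>s)"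
  have \<phi>s: "set \<phi>s = {Neg (Eq i j) | i j. i < n \<and> j < n \<and> i \<noteq> j}
      \<union> {Adj i j | i j. i < n \<and> j < n \<and> EF (h i) (h j)}"
    by (auto simp: \<phi>s_def split: if_splits)
  have "fv \<phi> \<subseteq> {0..<n}" if "\<phi> \<in> set \<phi>s" for \<phi>
    using that by (auto simp: \<phi>s)
  then have sent: "sentence \<Phi>"
    unfolding sentence_def \<Phi>_def fv_foldr_Ex fv_conj_list by auto
  have mat: "sat V E \<tau> (conj_list \<phi>s) \<longleftrightarrow>
      inj_on \<tau> {0..<n} \<and> (\<forall>i<n. \<forall>j<n. EF (h i) (h j) \<longrightarrow> E (\<tau> i) (\<tau> j))"
    for V :: "nat set" and E \<tau>
  proof -
    have ball: "(\<forall>\<phi>\<in>{F i j | i j. Q i j}. S \<phi>) \<longleftrightarrow> (\<forall>i j. Q i j \<longrightarrow> S (F i j))"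
      for F :: "nat \<Rightarrow> nat \<Rightarrow> fo" and Q S by blast
    show ?thesis
      unfolding sat_conj_list \<phi>s ball_Un ball inj_on_def
      by (simp add: Ball_def) blast
  qed
  \<comment> \<open>The equivalence holds for all \<open>V\<close> and \<open>E\<close>, so any
    threshold on the size of the host will do.\<close>
  have "sat V E \<sigma> \<Phi> \<longleftrightarrow> contains_subgraph V E VF EF" for V :: "nat set" and E \<sigma>
  proof
    assume "sat V E \<sigma> \<Phi>"
    then obtain \<tau> where \<tau>: "\<forall>i<n. \<tau> i \<in> V" "inj_on \<tau> {0..<n}"
      "\<forall>i<n. \<forall>j<n. EF (h i) (h j) \<longrightarrow> E (\<tau> i) (\<tau> j)"
      unfolding \<Phi>_def sat_foldr_Ex mat by (fastforce simp: Ball_def)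
    define g where "g = the_inv_into {0..<n} h"
    have g: "bij_betw g VF {0..<n}" unfolding g_def using h by (rule bij_betw_the_inv_into)
    have hg: "h (g v) = v" if "v \<in> VF" for v
      unfolding g_def using h that by (auto simp: bij_betw_def intro: f_the_inv_into_f)
    have gn: "g v < n" if "v \<in> VF" for v using g that by (auto dest: bij_betwE)
    have "inj_on (\<tau> \<circ> g) VF" using g \<tau>(2) by (auto simp: bij_betw_def intro: comp_inj_on)
    then show "contains_subgraph V E VF EF"
      unfolding contains_subgraph_def using \<tau> gn hg by (intro exI[of _ "\<tau> \<circ> g"]) auto
  next
    assume "contains_subgraph V E VF EF"
    then obtain f where f: "inj_on f VF" "f ` VF \<subseteq> V" "\<forall>u\<in>VF. \<forall>v\<in>VF. EF u v \<longrightarrow> E (f u) (f v)"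
      unfolding contains_subgraph_def by blast
    define \<tau> where "\<tau> = (\<lambda>i. if i < n then f (h i) else \<sigma> i)"
    have hV: "h i \<in> VF" if "i < n" for i using h that by (auto dest: bij_betwE)
    have "inj_on (f \<circ> h) {0..<n}" using h f(1) by (auto simp: bij_betw_def intro: comp_inj_on)
    then have "inj_on \<tau> {0..<n}" by (auto simp: \<tau>_def inj_on_def)
    then show "sat V E \<sigma> \<Phi>"
      unfolding \<Phi>_def sat_foldr_Ex mat using f hV by (intro exI[of _ \<tau>]) (auto simp: \<tau>_def)
  qed
  then show ?thesis using sent unfolding defines_F_ev_def by blast
qed

section \<open>Long paths and large stars\<close>

text \<open>The centre is 0, like the end of the path, so both graphs are glued to the clique at the
  same vertex.\<close>

definition star_E :: "nat \<Rightarrow> nat \<Rightarrow> nat \<Rightarrow> bool" where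
  "star_E n i j \<longleftrightarrow> i < n \<and> j < n \<and> i \<noteq> j \<and> (i = 0 \<or> j = 0)"

lemma connected_graphI_root:
  assumes g: "is_graph V E" and r: "r \<in> V" "\<And>v. v \<in> V \<Longrightarrow> E\<^sup>*\<^sup>* r v"
  shows "connected_graph V E"
proof -
  have "symp E" using g by (auto simp: is_graph_def symp_def)
  then have "E\<^sup>*\<^sup>* v r" if "v \<in> V" for v
    using r(2)[OF that] by (meson symp_rtranclp sympD)
  then have "E\<^sup>*\<^sup>* u v" if "u \<in> V" "v \<in> V" for u v
    using r that by (meson rtranclp_trans)
  then show ?thesis using g r unfolding connected_graph_def by blast
qed

lemma connected_path: "n > 0 \<Longrightarrow> connected_graph {0..<n} (path_E n)"
proof (rule connected_graphI_root)
  show "is_graph {0..<n} (path_E n)" by (auto simp: is_graph_def path_E_def)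
  have "(path_E n)\<^sup>*\<^sup>* 0 i" if "i < n" for i
    using that
  proof (induction i)
    case (Suc i)
    then have "path_E n i (Suc i)" by (simp add: path_E_def)
    then show ?case using Suc by (meson Suc_lessD rtranclp.rtrancl_into_rtrancl)
  qed simp
  then show "(path_E n)\<^sup>*\<^sup>* 0 i" if "i \<in> {0..<n}" for i using that by simp
qed auto

lemma connected_star: "n > 0 \<Longrightarrow> connected_graph {0..<n} (star_E n)"
proof (rule connected_graphI_root)
  show "is_graph {0..<n} (star_E n)" by (auto simp: is_graph_def star_E_def)
  show "(star_E n)\<^sup>*\<^sup>* 0 i" if "i \<in> {0..<n}" for i
  proof (cases "i = 0")
    case False
    then have "star_E n 0 i" using that by (simp add: star_E_def)
    then show ?thesis by blast
  qed simp
qed auto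

text \<open>The form in which connectivity of F is exploited: local information about neighbours
  yields a set containing all vertices.\<close>

lemma connected_graph_closed_subset:
  assumes "connected_graph V E" "x \<in> S" "x \<in> V" "\<And>u v. u \<in> S \<Longrightarrow> E u v \<Longrightarrow> v \<in> S"
  shows "V \<subseteq> S"
proof
  fix y assume "y \<in> V"
  then have "E\<^sup>*\<^sup>* x y" using assms by (auto simp: connected_graph_def)
  then show "y \<in> S" by induction (use assms in auto)
qed

lemma graph_iso_path3:
  assumes g: "is_graph {a, c, b} E" and "a \<noteq> b" "a \<noteq> c" "b \<noteq> c" "E a c" "E b c" "\<not> E a b"
  shows "graph_iso {a, c, b} E (path_V 3) (path_E 3)"
proof -
  define f where "f = (\<lambda>x. if x = a then 0 else if x = c then 1 else 2::nat)"
  have "{0..<3} = {0, 1, 2::nat}" by auto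
  then have "bij_betw f {a, c, b} (path_V 3)"
    using assms by (auto simp: f_def path_V_def bij_betw_def inj_on_def)
  moreover have "\<forall>u v. E u v \<longrightarrow> E v u" "\<forall>u. \<not> E u u" using g by (auto simp: is_graph_def)
  ultimately show ?thesis
    unfolding graph_iso_def using assms by (intro exI[of _ f]) (auto simp: f_def path_E_def)
qed

lemma graph_iso_path2:
  assumes c: "connected_graph V E" and "card V = 2"
  shows "graph_iso V E (path_V 2) (path_E 2)"
proof -
  obtain a b where V: "V = {a, b}" and ab: "a \<noteq> b" using assms(2) by (meson card_2_iff)
  have g: "\<forall>u v. E u v \<longrightarrow> E v u" "\<forall>u. \<not> E u u" "\<forall>u v. E u v \<longrightarrow> u \<in> V \<and> v \<in> V"
    using c by (auto simp: connected_graph_def is_graph_def)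
  have "E a b"
  proof (rule ccontr)
    assume "\<not> E a b"
    then have "V \<subseteq> {a}" using g V by (intro connected_graph_closed_subset[OF c]) auto
    then show False using V ab by auto
  qed
  define f where "f = (\<lambda>x. if x = a then 0 else 1::nat)"
  have "{0..<2} = {0, 1::nat}" by auto
  then have "bij_betw f V (path_V 2)"
    using ab V by (auto simp: f_def path_V_def bij_betw_def inj_on_def)
  then show ?thesis
    unfolding graph_iso_def using g \<open>E a b\<close> ab V
    by (intro exI[of _ f]) (auto simp: f_def path_E_def)
qed

section \<open>Incompatibility of the path and star embeddings\<close>

lemma not_both_embeddings:
  fixes VF :: "'a set"
  assumes conn: "connected_graph VF EF" and v3: "card VF \<ge> 3"
    and nP3: "\<not> graph_iso VF EF (path_V 3) (path_E 3)"
    and A: "finite A" "A \<inter> {0..<N} = {}" "2 * Suc (card A) \<le> card VF"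
    and path: "contains_subgraph ({0..<N} \<union> A) (clique_glued (path_E N) 0 A) VF EF"
    and star: "contains_subgraph ({0..<N} \<union> A) (clique_glued (star_E N) 0 A) VF EF"
  shows False
proof -
  let ?V = "{0..<N} \<union> A" and ?P = "clique_glued (path_E N) 0 A" and ?S = "clique_glued (star_E N) 0 A"
  have fin: "finite VF" and sym: "\<And>u v. EF u v \<Longrightarrow> EF v u"
    and inV: "\<And>u v. EF u v \<Longrightarrow> u \<in> VF \<and> v \<in> VF"
    using conn by (auto simp: connected_graph_def is_graph_def)
  note closed = connected_graph_closed_subset[OF conn]
  obtain f where f: "inj_on f VF" "f ` VF \<subseteq> ?V" and "\<forall>u\<in>VF. \<forall>v\<in>VF. EF u v \<longrightarrow> ?P (f u) (f v)"
    using path unfolding contains_subgraph_def by blast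
  then have fE: "\<And>u v. EF u v \<Longrightarrow> ?P (f u) (f v)" using inV by blast
  obtain g where g: "inj_on g VF" "g ` VF \<subseteq> ?V" and "\<forall>u\<in>VF. \<forall>v\<in>VF. EF u v \<longrightarrow> ?S (g u) (g v)"
    using star unfolding contains_subgraph_def by blast
  then have gE: "\<And>u v. EF u v \<Longrightarrow> ?S (g u) (g v)" using inV by blast
  \<comment> \<open>Vertices of F not sent to positions 1 to \<open>N - 1\<close> are sent
    injectively into the clique \<open>insert 0 A\<close>.\<close>
  have outside: "card VF \<le> Suc (card A) + card {x\<in>VF. 0 < h x \<and> h x < N}"
    if h: "inj_on h VF" "h ` VF \<subseteq> ?V" for h
  proof -
    let ?Q = "{x\<in>VF. 0 < h x \<and> h x < N}"
    have "h ` (VF - ?Q) \<subseteq> insert 0 A" using h(2) by auto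
    moreover have "inj_on h (VF - ?Q)" using h(1) by (rule inj_on_subset) auto
    ultimately have "card (VF - ?Q) \<le> card (insert 0 A)"
      using A(1) by (intro card_inj_on_le[of h]) simp_all
    also have "\<dots> \<le> Suc (card A)" using A(1) by (simp add: card_insert_if)
    finally have "card (VF - ?Q) \<le> Suc (card A)" .
    moreover have "card (VF - ?Q) = card VF - card ?Q"
      using fin by (intro card_Diff_subset) auto
    ultimately show ?thesis by linarith
  qed
  define P where "P = {x\<in>VF. 0 < f x \<and> f x < N}"
  define L where "L = {x\<in>VF. 0 < g x \<and> g x < N}"
  have cP: "card VF \<le> Suc (card A) + card P" unfolding P_def using outside[OF f] .
  have cL: "card VF \<le> Suc (card A) + card L" unfolding L_def using outside[OF g] .
  have finPL: "finite P" "finite L" using fin by (auto simp: P_def L_def)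
  have P2: "card P \<ge> 2" using cP A(3) v3 by presburger
  have L2: "card L \<ge> 2" using cL A(3) v3 by presburger
  \<comment> \<open>A leaf of the star has only the centre as a neighbour. By injectivity of
    \<open>g\<close>, all vertices of \<open>L\<close> therefore share a single neighbour
    \<open>c\<close> in F.\<close>
  have leaf: "g y = 0" if "x \<in> L" "EF x y" for x y
    using gE[OF that(2)] that(1) A(2) by (auto simp: L_def clique_glued_def star_E_def)
  have nbr: "\<exists>y. EF x y" if "x \<in> VF" for x
  proof (rule ccontr)
    assume "\<not> (\<exists>y. EF x y)"
    then have "VF \<subseteq> {x}" using that by (intro closed) auto
    then have "card VF \<le> 1" using card_mono[of "{x}" VF] by simp
    then show False using v3 by simp
  qed
  obtain l1 l2 where l: "l1 \<in> L" "l2 \<in> L" "l1 \<noteq> l2"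
    using L2 by (metis card_le_Suc0_iff_eq finPL(2) not_less_eq_eq numeral_2_eq_2)
  have LV: "x \<in> VF" if "x \<in> L" for x using that by (simp add: L_def)
  obtain c where c: "EF l1 c" using nbr LV[OF l(1)] by blast
  have cV: "c \<in> VF" and gc: "g c = 0" using inV[OF c] leaf[OF l(1) c] by auto
  have Lc: "y = c" if "x \<in> L" "EF x y" for x y
    using leaf[OF that] gc cV inV[OF that(2)] inj_onD[OF g(1), of y c] by simp
  have LcE: "EF x c" if "x \<in> L" for x using nbr[OF LV[OF that]] Lc[OF that] by blast
  have cL': "c \<notin> L" using gc by (simp add: L_def)
  \<comment> \<open>The clique adds no edge at positions 1 to \<open>N - 1\<close>, so a vertex of
    \<open>P\<close> has at most two neighbours in F, at consecutive positions.\<close>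
  have fP: "f y = f x + 1 \<or> f x = f y + 1" "f y < N" if "x \<in> P" "EF x y" for x y
    using fE[OF that(2)] that(1) A(2) by (auto simp: P_def clique_glued_def path_E_def)
  \<comment> \<open>If \<open>c\<close> were on the path, its only neighbours would be
    \<open>l1\<close> and \<open>l2\<close>, which have no neighbour but \<open>c\<close>; F would
    be a path on three vertices.\<close>
  have cnP: "c \<notin> P"
  proof
    assume cp: "c \<in> P"
    have "y = l1 \<or> y = l2" if "EF c y" for y
    proof -
      have "f y = f l1 \<or> f y = f l2 \<or> f l1 = f l2"
        using fP(1)[OF cp that] fP(1)[OF cp sym[OF LcE[OF l(1)]]] fP(1)[OF cp sym[OF LcE[OF l(2)]]]
        by linarith
      then show ?thesis using inj_onD[OF f(1)] inV[OF that] LV l by metis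
    qed
    then have "VF \<subseteq> {l1, c, l2}" using cV Lc l by (intro closed[of c]) blast+
    then have VF: "VF = {l1, c, l2}" using cV l LV by auto
    have "graph_iso {l1, c, l2} EF (path_V 3) (path_E 3)"
    proof (rule graph_iso_path3)
      show "is_graph {l1, c, l2} EF" using conn VF by (simp add: connected_graph_def)
    qed (use l cL' LcE Lc in auto)
    then show False using nP3 VF by simp
  qed
  \<comment> \<open>A common vertex \<open>x\<close> has \<open>c\<close> as its only neighbour.
    Since \<open>c\<close> is on the path but outside \<open>P\<close>, it sits at 0 and
    \<open>x\<close> at 1. The vertices of \<open>P\<close> beyond position 1 are then cut off from
    \<open>x\<close>, against connectivity; \<open>card P \<ge> 2\<close> ensures that there is such
    a vertex \<open>y\<close>.\<close>
  have PL: "P \<inter> L = {}"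
  proof (rule ccontr)
    assume "P \<inter> L \<noteq> {}"
    then obtain x where x: "x \<in> P" "x \<in> L" by blast
    have xc: "EF x c" using LcE x(2) .
    have "f c = 0" using cnP cV fP(2)[OF x(1) xc] by (auto simp: P_def)
    then have fx: "f x = 1" using fP(1)[OF x(1) xc] by auto
    obtain y where y: "y \<in> P" "y \<noteq> x"
      using P2 by (metis card_le_Suc0_iff_eq finPL(1) not_less_eq_eq numeral_2_eq_2)
    let ?C = "{z\<in>P. f z \<noteq> 1}"
    have xV: "x \<in> VF" using x(1) by (simp add: P_def)
    have "VF \<subseteq> ?C"
    proof (rule closed)
      show "y \<in> ?C" using y xV fx inj_onD[OF f(1), of y x] by (auto simp: P_def)
      show "y \<in> VF" using y by (simp add: P_def)
      fix u w assume u: "u \<in> ?C" and uw: "EF u w"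
      have "f u > 0" using u by (simp add: P_def)
      then have w0: "f w > 0" using fP(1)[of u w] u uw by auto
      have "f w \<noteq> 1"
      proof
        assume "f w = 1"
        then have "w = x" using fx xV inV[OF uw] inj_onD[OF f(1), of w x] by simp
        then have "u = c" using Lc[OF x(2)] sym[OF uw] by simp
        then show False using u cnP by simp
      qed
      then show "w \<in> ?C" using w0 fP(2)[of u w] u uw inV[OF uw] by (simp add: P_def)
    qed
    then show False using xV fx by auto
  qed
  \<comment> \<open>\<open>P\<close> and \<open>L\<close> each contain at least half of the vertices
    of F, which leaves no room for \<open>c\<close>.\<close>
  have "card (insert c (P \<union> L)) = Suc (card P + card L)"
    using finPL PL cnP cL' by (simp add: card_Un_disjoint)
  moreover have "card (insert c (P \<union> L)) \<le> card VF"
    using fin cV by (intro card_mono) (auto simp: P_def L_def)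
  ultimately show False using cP cL A(3) by presburger
qed

section \<open>The lower bounds\<close>

lemma defining_sentence_bounds:
  assumes conn: "connected_graph VF EF" and v3: "card VF \<ge> 3"
    and nP3: "\<not> graph_iso VF EF (path_V 3) (path_E 3)"
    and defn: "defines_F_ev VF EF \<Phi>"
  shows "card VF div 2 < qdepth \<Phi> \<and> card VF div 2 \<le> width \<Phi>"
proof (rule ccontr)
  assume neg: "\<not> ?thesis"
  define s where "s = card VF div 2"
  have s: "card (vars \<Phi>) < s \<or> qdepth \<Phi> \<le> s" using neg by (auto simp: s_def width_def)
  obtain k where sent: "sentence \<Phi>"
    and k: "\<And>V E. connected_graph (V::nat set) E \<Longrightarrow> card V \<ge> k \<Longrightarrow>
        sat V E (\<lambda>_. undefined) \<Phi> \<longleftrightarrow> contains_subgraph V E VF EF"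
    using defn unfolding defines_F_ev_def by blast
  \<comment> \<open>\<open>Suc k\<close> makes every gluing large enough for the threshold
    \<open>k\<close> and guarantees that the gluing vertex 0 exists.\<close>
  define N where "N = Suc k"
  \<comment> \<open>For \<open>m \<ge> 1\<close> these \<open>m - 1\<close> new vertices form with 0
    a clique of size \<open>m\<close>.\<close>
  define A where "A m = {N..<N + (m - 1)}" for m
  have A: "finite (A m)" "{0..<N} \<inter> A m = {}" "card (A m) = m - 1" for m by (auto simp: A_def)
  have small: "contains_subgraph ({0..<N} \<union> A s) (clique_glued E 0 (A s)) VF EF"
    if E: "connected_graph {0..<N} E" for E
  proof -
    let ?V = "\<lambda>m. {0..<N} \<union> A m" and ?E = "\<lambda>m. clique_glued E 0 (A m)"
    have "card {0..<N} \<le> card (?V m)" for m using A(1) by (intro card_mono) auto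
    then have iff: "sat (?V m) (?E m) (\<lambda>_. undefined) \<Phi> \<longleftrightarrow> contains_subgraph (?V m) (?E m) VF EF" for m
      using A(1) by (intro k connected_clique_glued[OF E]) (auto simp: N_def intro: Suc_leD)
    have "contains_subgraph (?V (card VF)) (?E (card VF)) VF EF"
    proof (rule contains_subgraph_clique[of _ _ "insert 0 (A (card VF))"])
      show "is_graph VF EF" using conn by (simp add: connected_graph_def)
      have "0 \<notin> A (card VF)" by (simp add: A_def N_def)
      then show "card VF \<le> card (insert 0 (A (card VF)))" using A by simp
    qed (use A in \<open>auto simp: clique_glued_def N_def\<close>)
    \<comment> \<open>Truth of the sentence passes from the clique of size \<open>card VF\<close>,
      where F certainly embeds, to the one of size \<open>s\<close>.\<close>
    moreover have "sat (?V (card VF)) (?E (card VF)) (\<lambda>_. undefined) \<Phi>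
        \<longleftrightarrow> sat (?V s) (?E s) (\<lambda>_. undefined) \<Phi>"
      using E A s by (intro clique_glued_sat_iff[OF sent, where s = s])
        (auto simp: connected_graph_def s_def N_def)
    ultimately show ?thesis using iff by simp
  qed
  have "N > 0" by (simp add: N_def)
  show False
  proof (rule not_both_embeddings[OF conn v3 nP3])
    show "finite (A s)" "A s \<inter> {0..<N} = {}" using A by auto
    show "2 * Suc (card (A s)) \<le> card VF" using v3 by (simp add: A s_def)
  qed (use small connected_path connected_star \<open>N > 0\<close> in auto)
qed

text \<open>Atoms always have free variables. This settles the case of F with one vertex, where the
  depth bound equals 1.\<close>

lemma fv_empty_imp_qdepth_pos: "fv \<phi> = {} \<Longrightarrow> qdepth \<phi> > 0"
  by (induction \<phi>) auto

theorem theorem5: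
  fixes VF :: "'a set" and EF :: "'a \<Rightarrow> 'a \<Rightarrow> bool"
  assumes "connected_graph VF EF"
    and "\<not> graph_iso VF EF (path_V 2) (path_E 2)"
    and "\<not> graph_iso VF EF (path_V 3) (path_E 3)"
  shows "real (D_v VF EF) \<ge> (real (card VF) + 1) / 2
       \<and> real (W_v VF EF) \<ge> (real (card VF) - 1) / 2"
proof -
  have fin: "finite VF" "VF \<noteq> {}"
    using assms(1) by (auto simp: connected_graph_def is_graph_def)
  obtain \<Phi> where \<Phi>: "defines_F_ev VF EF \<Phi>"
    using ex_defining_sentence[OF fin(1)] by blast
  obtain \<Phi>D where D: "defines_F_ev VF EF \<Phi>D" "qdepth \<Phi>D = D_v VF EF"
    using LeastI[of "\<lambda>d. \<exists>\<Phi>. defines_F_ev VF EF \<Phi> \<and> qdepth \<Phi> = d"] \<Phi>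
    unfolding D_v_def by blast
  obtain \<Phi>W where W: "defines_F_ev VF EF \<Phi>W" "width \<Phi>W = W_v VF EF"
    using LeastI[of "\<lambda>w. \<exists>\<Phi>. defines_F_ev VF EF \<Phi> \<and> width \<Phi> = w"] \<Phi>
    unfolding W_v_def by blast
  \<comment> \<open>A connected graph on two vertices is the excluded path, so only one vertex or at
    least three remain.\<close>
  have "card VF \<noteq> 0" "card VF \<noteq> 2" using fin graph_iso_path2 assms(1,2) by auto
  then consider "card VF = 1" | "card VF \<ge> 3" by linarith
  then show ?thesis
  proof cases
    case 1
    have "qdepth \<Phi>D > 0"
      using D(1) fv_empty_imp_qdepth_pos unfolding defines_F_ev_def sentence_def by blast
    then show ?thesis using 1 D(2) by simp
  next
    case 2
    have "card VF div 2 < D_v VF EF" "card VF div 2 \<le> W_v VF EF"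
      using defining_sentence_bounds[OF assms(1) 2 assms(3)] D W by metis+
    \<comment> \<open>The strict inequality for depth absorbs the rounding in
      \<open>card VF div 2\<close>; for width the rounding costs the extra 1.\<close>
    then have "card VF + 1 \<le> 2 * D_v VF EF" "card VF \<le> 2 * W_v VF EF + 1" by linarith+
    then have "real (card VF + 1) \<le> real (2 * D_v VF EF)" "real (card VF) \<le> real (2 * W_v VF EF + 1)"
      by (simp_all only: of_nat_le_iff)
    then show ?thesis by simp
  qed
qed

end
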